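(* Let $n\ge 3$. Every saturated precolored convex $\Theta^3$-drawing $\Gamma$ of a graph $G$ on $n$ vertices contains at least $\frac52 n-6$ edges.
   Context: Graphs are finite and simple. In a straight-line drawing, vertices are distinct points of the plane in general position (no three on a line) and edges are straight-line segments; two edges cross if their relative interiors share a point. A $\Theta^3$-drawing of a graph $G$ is a straight-line drawing $\Gamma$ of $G$ for which there exists an edge-coloring $\varphi\colon E(G)\to\{1,2,3\}$ such that no two edges of the same color cross. A precolored $\Theta^3$-drawing is a $\Theta^3$-drawing together with a fixed such coloring $\varphi$. The drawing is convex if its vertices are in convex position. A precolored $\Theta^3$-drawing $\Gamma$ with coloring $\varphi$ is saturated if there are no two distinct vertices $u,v$ with $uv\notin E(G)$ and no color $i\in\{1,2,3\}$ such that adding the straight-line edge $uv$ with color $i$ to $\Gamma$ (keeping the colors of all other edges) yields a drawing without monochromatic crossings. *)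

theory Defs
  imports "HOL-Analysis.Analysis"
begin

definition simple_graph :: "'a set \<Rightarrow> 'a set set \<Rightarrow> bool" where
  "simple_graph V E \<longleftrightarrow> finite V \<and> (\<forall>e\<in>E. e \<subseteq> V \<and> card e = 2)"

text \<open>
  A drawing is given by the positions of the vertices; the edge \<^term>\<open>e\<close> is drawn as the
  segment \<^term>\<open>convex hull (p ` e)\<close>.
\<close>

definition straight_line_drawing :: "'a set \<Rightarrow> 'a set set \<Rightarrow> ('a \<Rightarrow> real ^ 2) \<Rightarrow> bool" where
  "straight_line_drawing V E p \<longleftrightarrow>
     simple_graph V E \<and> inj_on p V \<and>
     (\<forall>u\<in>V. \<forall>v\<in>V. \<forall>w\<in>V. u \<noteq> v \<and> v \<noteq> w \<and> u \<noteq> w \<longrightarrow> \<not> collinear {p u, p v, p w})"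

definition crosses :: "('a \<Rightarrow> real ^ 2) \<Rightarrow> 'a set \<Rightarrow> 'a set \<Rightarrow> bool" where
  "crosses p e f \<longleftrightarrow>
     e \<noteq> f \<and> rel_interior (convex hull (p ` e)) \<inter> rel_interior (convex hull (p ` f)) \<noteq> {}"

definition no_monochromatic_crossing ::
    "'a set set \<Rightarrow> ('a \<Rightarrow> real ^ 2) \<Rightarrow> ('a set \<Rightarrow> nat) \<Rightarrow> bool" where
  "no_monochromatic_crossing E p \<phi> \<longleftrightarrow>
     (\<forall>e\<in>E. \<forall>f\<in>E. \<phi> e = \<phi> f \<longrightarrow> \<not> crosses p e f)"

text \<open>
  Edge colorings are total functions of which only the values on \<^term>\<open>E\<close> matter.
\<close>

definition precolored_theta3_drawing ::
    "'a set \<Rightarrow> 'a set set \<Rightarrow> ('a \<Rightarrow> real ^ 2) \<Rightarrow> ('a set \<Rightarrow> nat) \<Rightarrow> bool" where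
  "precolored_theta3_drawing V E p \<phi> \<longleftrightarrow>
     straight_line_drawing V E p \<and> \<phi> \<in> E \<rightarrow> {1, 2, 3} \<and> no_monochromatic_crossing E p \<phi>"

definition convex_drawing :: "'a set \<Rightarrow> ('a \<Rightarrow> real ^ 2) \<Rightarrow> bool" where
  "convex_drawing V p \<longleftrightarrow> (\<forall>v\<in>V. p v extreme_point_of (convex hull (p ` V)))"

definition saturated ::
    "'a set \<Rightarrow> 'a set set \<Rightarrow> ('a \<Rightarrow> real ^ 2) \<Rightarrow> ('a set \<Rightarrow> nat) \<Rightarrow> bool" where
  "saturated V E p \<phi> \<longleftrightarrow>
     \<not> (\<exists>u\<in>V. \<exists>v\<in>V. \<exists>i\<in>{1, 2, 3}. u \<noteq> v \<and> {u, v} \<notin> E \<and>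
          no_monochromatic_crossing (insert {u, v} E) p (\<phi>({u, v} := i)))"

end

theory Submission
  imports Defs
begin

text \<open>
  If the pairs of five vertices are crossed by no edge of colour \<open>i\<close>, then saturation
  puts all of them into the graph, and their five diagonals avoid colour \<open>i\<close>. The crossing graph of
  these diagonals is a 5-cycle, which two colours cannot colour properly. Hence every cell cut out
  by the diagonals of a single colour has at most four vertices, so each colour has at least
  \<open>n/2 - 2\<close> diagonals. The \<open>n\<close> hull edges are crossed by nothing and hence all present.
\<close>

section \<open>Orientations of points in convex position\<close>

text \<open>Read \<open>ccw a b c\<close> as a left turn from \<open>a\<close> via \<open>b\<close>
  to \<open>c\<close>. Everything combinatorial rests on these laws alone;
  \<open>not_in_triangle\<close> is convex position, since its three turns would put
  \<open>x\<close> inside the triangle \<open>a b c\<close>.\<close>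

locale convex_orientation =
  fixes V :: "'a set" and ccw :: "'a \<Rightarrow> 'a \<Rightarrow> 'a \<Rightarrow> bool"
  assumes finite_V: "finite V"
    and ccw_rotate: "ccw a b c \<Longrightarrow> ccw b c a"
    and ccw_asym: "ccw a b c \<Longrightarrow> \<not> ccw b a c"
    and ccw_total: "\<lbrakk>a \<in> V; b \<in> V; c \<in> V; a \<noteq> b; b \<noteq> c; a \<noteq> c\<rbrakk> \<Longrightarrow> ccw a b c \<or> ccw b a c"
    and not_in_triangle: "\<lbrakk>x \<in> V; a \<in> V; b \<in> V; c \<in> V; ccw x a b; ccw x b c\<rbrakk> \<Longrightarrow> \<not> ccw x c a"
begin

section \<open>The order of the vertices seen from one of them\<close>

lemma ccw_distinct: "ccw a b c \<Longrightarrow> a \<noteq> b \<and> b \<noteq> c \<and> a \<noteq> c"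
  using ccw_rotate[of a b c] ccw_rotate[of b c a] ccw_asym by blast

text \<open>Otherwise \<open>ccw v c a\<close> holds and \<open>v\<close> lies inside the triangle
  \<open>a b c\<close>. Together with \<open>ccw_total\<close>, this makes \<open>ccw v\<close> a
  strict linear order on the vertices other than \<open>v\<close>.\<close>

lemma ccw_trans:
  assumes "v \<in> V" "a \<in> V" "b \<in> V" "c \<in> V" "ccw v a b" "ccw v b c"
  shows "ccw v a c"
proof -
  have "a \<noteq> c" using assms ccw_asym ccw_rotate by metis
  then show ?thesis
    using assms ccw_total[of v a c] ccw_distinct not_in_triangle[of v a b c] ccw_rotate by metis
qed

text \<open>Least elements of these orders supply the successor along the hull and sort five
  points.\<close>

lemma exists_first:
  assumes "finite A" "A \<noteq> {}" "A \<subseteq> V - {v}" "v \<in> V"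
  shows "\<exists>m\<in>A. \<forall>w\<in>A - {m}. ccw v m w"
  using assms
proof (induction A rule: finite_ne_induct)
  case (singleton x)
  then show ?case by simp
next
  case (insert x A)
  then obtain m where m: "m \<in> A" "\<forall>w\<in>A - {m}. ccw v m w" by auto
  have "m \<noteq> x" using m insert by auto
  then consider "ccw v m x" | "ccw v x m"
    using ccw_total[of v m x] ccw_rotate insert.prems m(1) by blast
  then show ?case
  proof cases
    case 1
    then show ?thesis using m by auto
  next
    case 2
    have "ccw v x w" if "w \<in> insert x A - {x}" for w
    proof (cases "w = m")
      case False
      then show ?thesis using ccw_trans[of v x m w] 2 m that insert.prems by blast
    qed (use 2 in simp)
    then show ?thesis by blast
  qed
qed

section \<open>Separation and crossing of pairs\<close>

definition separates :: "'a \<Rightarrow> 'a \<Rightarrow> 'a \<Rightarrow> 'a \<Rightarrow> bool" where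
  "separates a b c d \<longleftrightarrow> ccw a b c \<and> ccw b a d \<or> ccw a b d \<and> ccw b a c"

text \<open>If \<open>a\<close> and \<open>b\<close> were on the same side of \<open>c d\<close>,
  one of them would lie inside the triangle of the other three points. Hence separation by a line
  already means that the two chords cross.\<close>

lemma separates_sym:
  assumes "a \<in> V" "b \<in> V" "c \<in> V" "d \<in> V" "separates a b c d"
  shows "separates c d a b"
proof -
  have *: "separates c d a b" if h: "ccw a b c" "ccw b a d" "c \<in> V" "d \<in> V" for c d
  proof -
    have ne: "a \<noteq> c" "a \<noteq> d" "b \<noteq> c" "b \<noteq> d" "c \<noteq> d"
      using h ccw_distinct ccw_asym by metis+
    have "\<not> (ccw c d a \<and> ccw c d b)"
      using not_in_triangle[of a b c d] h assms ccw_rotate by metis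
    moreover have "\<not> (ccw d c a \<and> ccw d c b)"
      using not_in_triangle[of b a d c] h assms ccw_rotate by metis
    ultimately show ?thesis
      using ccw_total[of c d a] ccw_total[of c d b] ne h assms unfolding separates_def by blast
  qed
  have sw: "separates d c a b \<Longrightarrow> separates c d a b"
    unfolding separates_def by blast
  show ?thesis
    using assms(5) *[of c d] *[of d c] assms(3,4) sw unfolding separates_def by blast
qed

lemma separates_commute: "separates a b c d = separates b a c d" "separates a b c d = separates a b d c"
  unfolding separates_def by blast+

lemma separates_distinct: "separates a b c d \<Longrightarrow> distinct [a, b, c, d]"
  unfolding separates_def using ccw_distinct ccw_asym by auto

definition crossing :: "'a set \<Rightarrow> 'a set \<Rightarrow> bool" where
  "crossing e f \<longleftrightarrow> (\<exists>a b c d. e = {a, b} \<and> f = {c, d} \<and> separates a b c d)"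

lemma crossing_pairs: "crossing {a, b} {c, d} \<longleftrightarrow> separates a b c d"
  unfolding crossing_def by (auto simp: doubleton_eq_iff separates_def)

lemma crossing_sym:
  assumes "e \<subseteq> V" "f \<subseteq> V" "crossing e f"
  shows "crossing f e"
proof -
  obtain a b c d where "e = {a, b}" "f = {c, d}" "separates a b c d"
    using assms(3) unfolding crossing_def by blast
  then show ?thesis using assms(1,2) separates_sym[of a b c d] by (simp add: crossing_pairs)
qed

section \<open>Vertex pairs and cutting along chords\<close>

definition pairs :: "'a set \<Rightarrow> 'a set set" where
  "pairs W = {e. e \<subseteq> W \<and> card e = 2}"

lemma pairsE:
  assumes "e \<in> pairs W"
  obtains a b where "e = {a, b}" "a \<noteq> b" "a \<in> W" "b \<in> W"
  using assms unfolding pairs_def by (auto simp: card_2_iff)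

text \<open>Both endpoints of the chord belong to either side, so a cut along it leaves them in both
  parts.\<close>

definition closed_side :: "'a \<Rightarrow> 'a \<Rightarrow> 'a set" where
  "closed_side a b = {w. w = a \<or> w = b \<or> ccw a b w}"

lemma pair_within_side:
  assumes "a \<in> V" "b \<in> V" "a \<noteq> b" "e \<in> pairs V" "\<not> crossing {a, b} e"
  shows "e \<subseteq> closed_side a b \<or> e \<subseteq> closed_side b a"
proof -
  obtain c d where e: "e = {c, d}" "c \<noteq> d" "c \<in> V" "d \<in> V"
    using pairsE[OF assms(4)] by metis
  have "\<not> separates a b c d"
    using assms(5) by (simp add: e crossing_pairs)
  then show ?thesis
    using ccw_total[of a b c] ccw_total[of a b d] assms e
    unfolding separates_def closed_side_def by auto
qed

text \<open>Seen from \<open>c\<close>, a point \<open>d\<close> between \<open>y\<close> and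
  \<open>x\<close> would also be between \<open>a\<close> and \<open>b\<close>. As \<open>d\<close>
  is on the same side of the chord as \<open>c\<close>, it would lie inside the triangle
  \<open>a b c\<close>.\<close>

lemma ccw_through_chord:
  assumes V: "a \<in> V" "b \<in> V" "c \<in> V" "d \<in> V" "x \<in> V" "y \<in> V"
    and c: "ccw a b c" and d: "d \<in> closed_side a b"
    and xy: "x \<in> closed_side b a" "y \<in> closed_side b a" and y: "ccw c y d"
  shows "\<not> ccw c d x"
proof
  assume x: "ccw c d x"
  \<comment> \<open>Seen from \<open>c\<close>, the whole far side of the chord lies in the angle
    from \<open>a\<close> to \<open>b\<close>.\<close>
  have between: "(z = a \<or> ccw c a z) \<and> (z = b \<or> ccw c z b)"
    if "z \<in> V" "z \<in> closed_side b a" for z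
  proof (cases "z = a \<or> z = b")
    case True
    then show ?thesis using c ccw_rotate by blast
  next
    case False
    then have z: "ccw b a z" using that unfolding closed_side_def by auto
    have "ccw a z c" using ccw_trans[of a z b c] z c V that ccw_rotate by blast
    moreover have "ccw b c z" using ccw_trans[of b c a z] z c V that ccw_rotate by blast
    ultimately show ?thesis using ccw_rotate by blast
  qed
  have ad: "ccw c a d"
    using between[of y] y xy V ccw_trans[of c a y d] by blast
  have db: "ccw c d b"
    using between[of x] x xy V ccw_trans[of c d x b] by blast
  have "d \<noteq> a" "d \<noteq> b" using ad db ccw_distinct by metis+
  then have "ccw a b d" using d unfolding closed_side_def by auto
  then show False
    using not_in_triangle[of d a b c] ad db V ccw_rotate by metis
qed

text \<open>This makes the two parts of a cut independent: chords of one part cannot cross pairs of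
  the other.\<close>

lemma pairs_on_opposite_sides:
  assumes V: "a \<in> V" "b \<in> V" "a \<noteq> b"
    and e: "e \<in> pairs V" "e \<subseteq> closed_side a b"
    and f: "f \<in> pairs V" "f \<subseteq> closed_side b a"
  shows "\<not> crossing e f"
proof
  assume "crossing e f"
  then obtain c d x y where c: "e = {c, d}" "f = {x, y}" "separates c d x y"
    unfolding crossing_def by blast
  have inV: "c \<in> V" "d \<in> V" "x \<in> V" "y \<in> V"
    using e f c unfolding pairs_def by auto
  have sides: "c \<in> closed_side a b" "d \<in> closed_side a b"
      "x \<in> closed_side b a" "y \<in> closed_side b a"
    using e f c by auto
  note dist = separates_distinct[OF c(3)]
  consider "ccw a b c" | "ccw a b d" | "c = a \<and> d = b" | "c = b \<and> d = a"
    using sides dist unfolding closed_side_def by auto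
  then show False
  proof cases
    case 1
    then show False
      using ccw_through_chord[of a b c d x y] ccw_through_chord[of a b c d y x]
        c(3) sides V inV ccw_rotate unfolding separates_def by metis
  next
    case 2
    then show False
      using ccw_through_chord[of a b d c x y] ccw_through_chord[of a b d c y x]
        c(3) sides V inV ccw_rotate unfolding separates_def by metis
  next
    case 3
    then show False
      using c(3) sides dist ccw_asym unfolding separates_def closed_side_def by auto
  next
    case 4
    then show False
      using c(3) sides dist ccw_asym unfolding separates_def closed_side_def by auto
  qed
qed

text \<open>Cut along a chord of \<open>F\<close> and recurse into one part. The excess
  \<open>card W - 2 * card F - 4\<close> of the whole is the sum of the excesses of the parts, so it
  stays positive in one of them; without chords it says that five vertices are left.\<close>

lemma exists_uncrossed_five:
  assumes "finite F" "W \<subseteq> V" "F \<subseteq> pairs W"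
    and "\<And>e f. \<lbrakk>e \<in> F; f \<in> F\<rbrakk> \<Longrightarrow> \<not> crossing e f"
    and "2 * card F + 4 < card W"
  shows "\<exists>S\<subseteq>W. card S = 5 \<and> (\<forall>e\<in>pairs S. \<forall>f\<in>F. \<not> crossing e f)"
  using assms
proof (induction "card F" arbitrary: F W rule: less_induct)
  case less
  show ?case
  proof (cases "F = {}")
    case True
    then have "5 \<le> card W" using less.prems by simp
    then obtain S where "S \<subseteq> W" "card S = 5" using obtain_subset_with_card_n by metis
    then show ?thesis using True by blast
  next
    case False
    then obtain g where g: "g \<in> F" by blast
    then obtain a b where ab: "g = {a, b}" "a \<noteq> b" "a \<in> W" "b \<in> W"
      using less.prems(3) pairsE by (metis subsetD)
    have abV: "a \<in> V" "b \<in> V" using ab less.prems(2) by auto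
    have finW: "finite W" using less.prems(2) finite_V finite_subset by blast
    define W1 where "W1 = W \<inter> closed_side a b"
    define W2 where "W2 = W \<inter> closed_side b a"
    \<comment> \<open>The cutting chord is removed because its ends lie in both \<open>W1\<close>
      and \<open>W2\<close>, so it would be counted twice.\<close>
    define F1 where "F1 = {f \<in> F - {g}. f \<subseteq> W1}"
    define F2 where "F2 = {f \<in> F - {g}. f \<subseteq> W2}"
    have FV: "f \<in> pairs V" "f \<subseteq> W" "card f = 2" if "f \<in> F" for f
      using less.prems(2,3) that unfolding pairs_def by auto
    have WI: "W1 \<inter> W2 = {a, b}"
      unfolding W1_def W2_def closed_side_def using ab ccw_asym by blast
    have WU: "W1 \<union> W2 = W"
      unfolding W1_def W2_def closed_side_def
      using ccw_total[OF abV] ab less.prems(2) by blast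
    have "card W1 + card W2 = card (W1 \<union> W2) + card (W1 \<inter> W2)"
      using finW by (intro card_Un_Int) (auto simp: W1_def W2_def)
    then have cW: "card W1 + card W2 = card W + 2" using WI WU ab(2) by simp
    have within: "f \<subseteq> W1 \<or> f \<subseteq> W2" if "f \<in> F" for f
      using pair_within_side[OF abV ab(2) FV(1)[OF that]] less.prems(4)[OF g that] FV(2)[OF that] ab(1)
      unfolding W1_def W2_def by blast
    have FU: "F1 \<union> F2 = F - {g}" unfolding F1_def F2_def using within by blast
    have FI: "F1 \<inter> F2 = {}"
    proof (rule ccontr)
      assume "F1 \<inter> F2 \<noteq> {}"
      then obtain f where f: "f \<in> F" "f \<noteq> g" "f \<subseteq> {a, b}"
        unfolding F1_def F2_def using WI by blast
      then have "f = {a, b}" using FV(3)[OF f(1)] ab(2) by (intro card_subset_eq) auto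
      then show False using f ab by simp
    qed
    have finF: "finite F1" "finite F2" using less.prems(1) by (auto simp: F1_def F2_def)
    have "card F1 + card F2 = card (F - {g})"
      using card_Un_disjoint[OF finF FI] FU by simp
    then have cF: "card F1 + card F2 + 1 = card F"
      using g less.prems(1) by (metis Suc_eq_plus1 card_Suc_Diff1)
    \<comment> \<open>Stated for an unspecified side, so that it serves for \<open>W1\<close> and
      for \<open>W2\<close>.\<close>
    have step: "\<exists>S\<subseteq>W. card S = 5 \<and> (\<forall>e\<in>pairs S. \<forall>f\<in>F. \<not> crossing e f)"
      if W': "W' = W \<inter> closed_side a' b'" and W'': "W'' = W \<inter> closed_side b' a'"
        and F': "F' = {f \<in> F - {g}. f \<subseteq> W'}" and lt: "2 * card F' + 4 < card W'"
        and cov: "\<And>f. f \<in> F \<Longrightarrow> f \<subseteq> W' \<or> f \<subseteq> W''"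
        and ab': "g = {a', b'}" "a' \<noteq> b'" "a' \<in> V" "b' \<in> V" for a' b' W' W'' F'
    proof -
      have "F' \<subset> F" using F' g by blast
      then have "card F' < card F" using less.prems(1) psubset_card_mono by blast
      moreover have "F' \<subseteq> pairs W'" using F' FV(3) by (auto simp: pairs_def)
      moreover have "finite F'" "W' \<subseteq> V" using F' W' less.prems by auto
      ultimately obtain S where S: "S \<subseteq> W'" "card S = 5"
          "\<forall>e\<in>pairs S. \<forall>f\<in>F'. \<not> crossing e f"
        using less.hyps[of F' W'] lt less.prems(4) F' by blast
      have "\<not> crossing e f" if e: "e \<in> pairs S" and f: "f \<in> F" for e f
      proof (cases "f \<in> F'")
        case False
        \<comment> \<open>Such an \<open>f\<close> is either \<open>g\<close>, whose ends belong to
          both closed sides, or a chord of the other part.\<close>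
        then have "f \<subseteq> closed_side b' a'"
          using F' f cov[OF f] W'' ab'(1) unfolding closed_side_def by blast
        moreover have "e \<in> pairs V" "e \<subseteq> closed_side a' b'"
          using e S(1) W' less.prems(2) unfolding pairs_def by auto
        ultimately show ?thesis using pairs_on_opposite_sides ab' FV(1)[OF f] by blast
      qed (use S e in blast)
      then show ?thesis using S W' by blast
    qed
    \<comment> \<open>The two shared vertices add 2 and the lost chord adds 2, which pays for the
      second constant 4.\<close>
    have "2 * card F1 + 4 < card W1 \<or> 2 * card F2 + 4 < card W2"
      using cW cF less.prems(5) by linarith
    then show ?thesis
    proof
      assume "2 * card F1 + 4 < card W1"
      then show ?thesis using step[OF W1_def W2_def F1_def] within ab abV by blast
    next
      assume "2 * card F2 + 4 < card W2"
      then show ?thesis using step[OF W2_def W1_def F2_def] within ab abV by blast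
    qed
  qed
qed

section \<open>Five points and their diagonals\<close>

lemma separates_if_ccw_ordered:
  assumes "ccw a b c" "ccw a c d"
  shows "separates a c b d"
  unfolding separates_def using assms(2) ccw_rotate[OF ccw_rotate[OF assms(1)]] by blast

text \<open>The conclusion lists the five diagonals along the 5-cycle that they form in the crossing graph.\<close>

lemma five_crossing_diagonals:
  assumes "S \<subseteq> V" "card S = 5"
  shows "\<exists>e0 e1 e2 e3 e4. {e0, e1, e2, e3, e4} \<subseteq> pairs S \<and>
    crossing e0 e1 \<and> crossing e1 e2 \<and> crossing e2 e3 \<and> crossing e3 e4 \<and> crossing e4 e0"
proof -
  have finS: "finite S" using assms finite_V finite_subset by blast
  \<comment> \<open>Repeatedly taking the least element in the order \<open>ccw v0\<close> lists the
    other four points as \<open>v1\<close>, \<open>v2\<close>, \<open>v3\<close>,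
    \<open>v4\<close>.\<close>
  have next_vertex: "\<exists>m\<in>A. \<forall>w\<in>A - {m}. ccw v m w"
    if "A \<subseteq> S" "card A > 0" "v \<in> S" "v \<notin> A" for A v
    using exists_first[of A v] that assms finS card_gt_0_iff[of A] by blast
  obtain v0 where v0: "v0 \<in> S" using assms by fastforce
  define A1 where "A1 = S - {v0}"
  have A1: "card A1 = 4" "v0 \<notin> A1" "A1 \<subseteq> S" using v0 assms finS by (auto simp: A1_def)
  obtain v1 where v1: "v1 \<in> A1" "\<forall>w\<in>A1 - {v1}. ccw v0 v1 w"
    using next_vertex[of A1 v0] A1 v0 by auto
  define A2 where "A2 = A1 - {v1}"
  have A2: "card A2 = 3" "v0 \<notin> A2" "A2 \<subseteq> S"
    using v1 A1 finS by (auto simp: A2_def)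
  obtain v2 where v2: "v2 \<in> A2" "\<forall>w\<in>A2 - {v2}. ccw v0 v2 w"
    using next_vertex[of A2 v0] A2 v0 by auto
  define A3 where "A3 = A2 - {v2}"
  have A3: "card A3 = 2" "v0 \<notin> A3" "A3 \<subseteq> S"
    using v2 A2 finS by (auto simp: A3_def)
  obtain v3 where v3: "v3 \<in> A3" "\<forall>w\<in>A3 - {v3}. ccw v0 v3 w"
    using next_vertex[of A3 v0] A3 v0 by auto
  have "card (A3 - {v3}) = 1" using A3 v3 by simp
  then obtain v4 where v4: "v4 \<in> A3 - {v3}" by (metis One_nat_def card_1_singleton_iff insertI1)
  have c: "ccw v0 v1 v2" "ccw v0 v1 v3" "ccw v0 v1 v4" "ccw v0 v2 v3" "ccw v0 v2 v4" "ccw v0 v3 v4"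
    using v1 v2 v3 v4 unfolding A2_def A3_def by auto
  have inS: "{v0, v1, v2, v3, v4} \<subseteq> S"
    using v0 v1 v2 v3 v4 A1 A2 A3 by auto
  \<comment> \<open>The order seen from \<open>v0\<close> also orients triples without
    \<open>v0\<close>; otherwise \<open>c\<close> would lie inside the triangle
    \<open>b d v0\<close>.\<close>
  have away: "ccw b c d" if "ccw v0 b c" "ccw v0 c d" "b \<in> S" "c \<in> S" "d \<in> S" for b c d
  proof -
    have V: "v0 \<in> V" "b \<in> V" "c \<in> V" "d \<in> V" using that v0 assms by auto
    have bd: "ccw v0 b d" using ccw_trans[of v0 b c d] that V by blast
    have "\<not> ccw c b d"
      using not_in_triangle[of c b d v0] that V ccw_rotate by metis
    moreover have "b \<noteq> c" "c \<noteq> d" "b \<noteq> d" using that bd ccw_distinct by metis+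
    ultimately show ?thesis using ccw_total V by blast
  qed
  have "ccw v1 v2 v3" "ccw v1 v3 v4" using away c inS by auto
  then have "separates v1 v3 v2 v4" by (rule separates_if_ccw_ordered)
  moreover have "separates v0 v2 v1 v3" "separates v0 v2 v1 v4" "separates v0 v3 v1 v4"
      "separates v0 v3 v2 v4"
    using c separates_if_ccw_ordered by blast+
  moreover note inV = subset_trans[OF inS assms(1)]
  ultimately have "crossing {v0, v2} {v1, v3}" "crossing {v1, v3} {v2, v4}"
      "crossing {v2, v4} {v0, v3}" "crossing {v0, v3} {v1, v4}" "crossing {v1, v4} {v0, v2}"
    unfolding crossing_pairs by (auto intro: separates_sym)
  moreover have "{{v0, v2}, {v1, v3}, {v2, v4}, {v0, v3}, {v1, v4}} \<subseteq> pairs S"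
    using inS c ccw_distinct v4 unfolding pairs_def card_2_iff
    by (smt (verit) insert_subset mem_Collect_eq empty_subsetI)
  ultimately show ?thesis by blast
qed

section \<open>Hull edges and the edge count\<close>

definition hull_edges :: "'a set set" where
  "hull_edges = {e \<in> pairs V. \<forall>f\<in>pairs V. \<not> crossing e f}"

text \<open>Each vertex \<open>v\<close> is joined to the first vertex \<open>s v\<close> in its
  order. All other vertices are then to the left of this pair, so nothing crosses it.\<close>

lemma card_hull_edges:
  assumes "3 \<le> card V"
  shows "card V \<le> card hull_edges"
proof -
  have "\<exists>m\<in>V - {v}. \<forall>w\<in>V - {v} - {m}. ccw v m w" if "v \<in> V" for v
  proof (rule exists_first)
    have "card (V - {v}) \<noteq> 0" using that assms by simp
    then show "V - {v} \<noteq> {}" by (metis card.empty)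
  qed (use that finite_V in auto)
  then obtain s where s: "\<And>v. v \<in> V \<Longrightarrow> s v \<in> V - {v}"
      "\<And>v w. \<lbrakk>v \<in> V; w \<in> V - {v} - {s v}\<rbrakk> \<Longrightarrow> ccw v (s v) w"
    by metis
  have "inj_on (\<lambda>v. {v, s v}) V"
  proof (rule inj_onI, rule ccontr)
    fix v w assume vw: "v \<in> V" "w \<in> V" "{v, s v} = {w, s w}" "v \<noteq> w"
    then have sw: "s v = w" "s w = v" by (auto simp: doubleton_eq_iff)
    \<comment> \<open>If \<open>v\<close> and \<open>w\<close> were successors of each other, a
      third vertex would be on both sides of \<open>v w\<close>.\<close>
    have "card (V - {v} - {w}) \<noteq> 0" using vw assms by simp
    then obtain x where "x \<in> V - {v} - {w}" by (metis card.empty ex_in_conv)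
    then have "ccw v w x" "ccw w v x" using s(2)[of v x] s(2)[of w x] sw vw by auto
    then show False using ccw_asym by blast
  qed
  moreover have "(\<lambda>v. {v, s v}) ` V \<subseteq> hull_edges"
  proof clarify
    fix v assume v: "v \<in> V"
    have "\<not> crossing {v, s v} f" if fV: "f \<in> pairs V" for f
    proof
      assume cr: "crossing {v, s v} f"
      obtain x y where f: "f = {x, y}" "x \<in> V" "y \<in> V"
        using pairsE[OF fV] by metis
      have sep: "separates v (s v) x y" using cr by (simp add: f crossing_pairs)
      then have "ccw v (s v) x" "ccw v (s v) y"
        using s(2)[OF v, of x] s(2)[OF v, of y] f separates_distinct[OF sep] by auto
      then show False using sep ccw_asym unfolding separates_def by blast
    qed
    moreover have "{v, s v} \<in> pairs V" using v s(1)[OF v] by (auto simp: pairs_def)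
    ultimately show "{v, s v} \<in> hull_edges" unfolding hull_edges_def by blast
  qed
  moreover have "finite hull_edges"
    using finite_V by (auto simp: hull_edges_def pairs_def)
  ultimately show ?thesis by (metis card_inj_on_le)
qed

text \<open>The count is \<open>n + 3 * (n - 4) / 2 = 5 * n / 2 - 6\<close>, doubled and rearranged
  to stay within the natural numbers.\<close>

theorem card_saturated_three_colouring:
  assumes V: "3 \<le> card V"
    and E: "E \<subseteq> pairs V" and col: "\<phi> \<in> E \<rightarrow> {1, 2, 3 :: nat}"
    and mono: "\<And>e f. \<lbrakk>e \<in> E; f \<in> E; \<phi> e = \<phi> f\<rbrakk> \<Longrightarrow> \<not> crossing e f"
    and sat: "\<And>e i. \<lbrakk>e \<in> pairs V; e \<notin> E; i \<in> {1, 2, 3}\<rbrakk> \<Longrightarrow> \<exists>f\<in>E. \<phi> f = i \<and> crossing e f"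
  shows "5 * card V \<le> 2 * card E + 12"
proof -
  have finE: "finite E"
    using E finite_V by (rule_tac finite_subset[of _ "Pow V"]) (auto simp: pairs_def)
  have HE: "hull_edges \<subseteq> E"
  proof
    fix e assume "e \<in> hull_edges"
    \<comment> \<open>The colour 1 is an arbitrary choice: a missing pair is crossed in every
      colour, a hull edge in none.\<close>
    then show "e \<in> E" using sat[of e 1] E unfolding hull_edges_def by blast
  qed
  define F where "F i = {e \<in> E - hull_edges. \<phi> e = i}" for i
  have finF: "finite (F i)" for i using finE by (simp add: F_def)
  have bound: "card V \<le> 2 * card (F i) + 4" if i: "i \<in> {1, 2, 3}" for i
  proof (rule ccontr)
    assume "\<not> ?thesis"
    moreover have "F i \<subseteq> pairs V" using E by (auto simp: F_def)
    ultimately obtain S where S: "S \<subseteq> V" "card S = 5"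
        "\<forall>e\<in>pairs S. \<forall>f\<in>F i. \<not> crossing e f"
      using exists_uncrossed_five[of "F i" V] finF mono by (auto simp: F_def)
    have SV: "pairs S \<subseteq> pairs V" using S(1) by (auto simp: pairs_def)
    \<comment> \<open>An edge that crosses some pair is no hull edge. So avoiding \<open>F i\<close>
      means avoiding all edges of colour \<open>i\<close>.\<close>
    have FI: "f \<in> F i" if "e \<in> pairs S" "f \<in> E" "\<phi> f = i" "crossing e f" for e f
    proof -
      have ef: "e \<in> pairs V" "f \<in> pairs V" using that SV E by auto
      then have "crossing f e" using that(4) crossing_sym[of e f] by (simp add: pairs_def)
      then show ?thesis using that ef unfolding F_def hull_edges_def by blast
    qed
    have SE: "e \<in> E" if "e \<in> pairs S" for e
      using sat[of e i] FI[of e] S(3) that SV i by blast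
    \<comment> \<open>If \<open>e\<close> had colour \<open>i\<close>, it would be a member of
      \<open>F i\<close> crossing the pair \<open>f\<close> of \<open>S\<close>; likewise for
      \<open>f\<close>.\<close>
    have col': "\<phi> e \<in> {1, 2, 3} - {i} \<and> \<phi> f \<in> {1, 2, 3} - {i} \<and> \<phi> e \<noteq> \<phi> f"
      if ef: "e \<in> pairs S" "f \<in> pairs S" "crossing e f" for e f
    proof -
      have "e \<subseteq> V" "f \<subseteq> V" using ef S(1) by (auto simp: pairs_def)
      then have "crossing f e" using ef crossing_sym by blast
      then have "\<phi> e \<noteq> i" "\<phi> f \<noteq> i" using ef FI SE S(3) by blast+
      then show ?thesis using mono SE ef col by blast
    qed
    obtain e0 e1 e2 e3 e4 where e: "{e0, e1, e2, e3, e4} \<subseteq> pairs S"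
        "crossing e0 e1" "crossing e1 e2" "crossing e2 e3" "crossing e3 e4" "crossing e4 e0"
      using five_crossing_diagonals[OF S(1,2)] by (elim exE conjE) (rule that)
    obtain k l where kl: "{1, 2, 3} - {i} \<subseteq> {k, l}"
    proof -
      have "{1, 2, 3} - {i} \<subseteq> {2, 3} \<or> {1, 2, 3} - {i} \<subseteq> {1, 3} \<or> {1, 2, 3} - {i} \<subseteq> {1, 2}"
        using i by auto
      then show thesis using that by blast
    qed
    \<comment> \<open>With two colours left, each crossing flips the truth of
      \<open>\<phi> e = k\<close>; five flips around the cycle are contradictory.\<close>
    have two: "(\<phi> e = k \<or> \<phi> e = l) \<and> (\<phi> e = k \<longleftrightarrow> \<phi> f \<noteq> k)"
      if "e \<in> pairs S" "f \<in> pairs S" "crossing e f" for e f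
      using col'[OF that] kl by auto
    have "\<phi> e0 = k \<longleftrightarrow> \<phi> e1 \<noteq> k" "\<phi> e1 = k \<longleftrightarrow> \<phi> e2 \<noteq> k" "\<phi> e2 = k \<longleftrightarrow> \<phi> e3 \<noteq> k"
        "\<phi> e3 = k \<longleftrightarrow> \<phi> e4 \<noteq> k" "\<phi> e4 = k \<longleftrightarrow> \<phi> e0 \<noteq> k"
      using e two by simp_all
    then show False by blast
  qed
  have "E = hull_edges \<union> (F 1 \<union> (F 2 \<union> F 3))"
    using HE col unfolding F_def by blast
  then have "card E = card (hull_edges \<union> (F 1 \<union> (F 2 \<union> F 3)))" by simp
  also have "\<dots> = card hull_edges + (card (F 1) + (card (F 2) + card (F 3)))"
  proof -
    have "F 2 \<inter> F 3 = {}" "F 1 \<inter> (F 2 \<union> F 3) = {}" "hull_edges \<inter> (F 1 \<union> (F 2 \<union> F 3)) = {}"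
      by (auto simp: F_def)
    then show ?thesis
      using finF finite_subset[OF HE finE] by (simp add: card_Un_disjoint)
  qed
  finally show ?thesis
    using card_hull_edges[OF V] bound[of 1] bound[of 2] bound[of 3] by simp
qed

end

section \<open>Drawings in the plane\<close>

text \<open>Twice the signed area of the triangle \<open>a b c\<close>, positive for a left
  turn.\<close>

definition orient :: "real ^ 2 \<Rightarrow> real ^ 2 \<Rightarrow> real ^ 2 \<Rightarrow> real" where
  "orient a b c = (b $ 1 - a $ 1) * (c $ 2 - a $ 2) - (b $ 2 - a $ 2) * (c $ 1 - a $ 1)"

lemma orient_rotate: "orient b c a = orient a b c"
  unfolding orient_def by (simp add: algebra_simps)

lemma orient_swap: "orient b a c = - orient a b c"
  unfolding orient_def by (simp add: algebra_simps)

lemma orient_affine: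
  "orient a b ((1 - u) *\<^sub>R c + u *\<^sub>R d) = (1 - u) * orient a b c + u * orient a b d"
  unfolding orient_def by (simp add: algebra_simps)

lemma orient_self: "orient a b a = 0" "orient a b b = 0"
  unfolding orient_def by simp_all

text \<open>The parameter \<open>t\<close> is solved from a coordinate in which \<open>a\<close> and
  \<open>b\<close> differ; zero area settles the other coordinate.\<close>

lemma collinear_if_orient_eq_0:
  assumes "orient a b c = 0"
  shows "collinear {a, b, c}"
proof (cases "a = b")
  case False
  have "\<exists>t. c = (1 - t) *\<^sub>R a + t *\<^sub>R b"
  proof (cases "b $ 1 = a $ 1")
    case True
    then have ne: "b $ 2 - a $ 2 \<noteq> 0" using False by (simp add: vec_eq_iff forall_2)
    define t where "t = (c $ 2 - a $ 2) / (b $ 2 - a $ 2)"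
    have "t * (b $ 2 - a $ 2) = c $ 2 - a $ 2" using ne by (simp add: t_def)
    moreover have "c $ 1 = a $ 1" using ne assms True by (simp add: orient_def)
    ultimately have "c = (1 - t) *\<^sub>R a + t *\<^sub>R b"
      using True by (simp add: vec_eq_iff forall_2 algebra_simps)
    then show ?thesis by blast
  next
    case False
    define t where "t = (c $ 1 - a $ 1) / (b $ 1 - a $ 1)"
    have t: "t * (b $ 1 - a $ 1) = c $ 1 - a $ 1" using False by (simp add: t_def)
    have "t * (b $ 2 - a $ 2) * (b $ 1 - a $ 1) = (b $ 2 - a $ 2) * (c $ 1 - a $ 1)"
      unfolding t[symmetric] by (simp only: mult_ac)
    also have "\<dots> = (c $ 2 - a $ 2) * (b $ 1 - a $ 1)"
      using assms unfolding orient_def by (simp add: mult.commute)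
    finally have "t * (b $ 2 - a $ 2) = c $ 2 - a $ 2" using False by simp
    with t have "c = (1 - t) *\<^sub>R a + t *\<^sub>R b"
      by (simp add: vec_eq_iff forall_2 algebra_simps)
    then show ?thesis by blast
  qed
  then obtain t where "c = (1 - t) *\<^sub>R a + t *\<^sub>R b" by blast
  then have "c = t *\<^sub>R b + (1 - t) *\<^sub>R a" by simp
  then have "collinear {b, c, a}" unfolding collinear_3_expand by blast
  then show ?thesis by (simp add: insert_commute)
qed simp

text \<open>The signed areas of the three triangles at \<open>x\<close>, divided by their sum, are
  its barycentric coordinates.\<close>

lemma in_triangle_if_orient_pos:
  assumes "orient x a b > 0" "orient x b c > 0" "orient x c a > 0"
  shows "x \<in> convex hull {a, b, c}"
proof -
  define s where "s = orient x b c + orient x c a + orient x a b"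
  have s: "s > 0" using assms by (simp add: s_def)
  have "s *\<^sub>R x = orient x b c *\<^sub>R a + orient x c a *\<^sub>R b + orient x a b *\<^sub>R c"
    unfolding vec_eq_iff forall_2 s_def orient_def by (simp add: algebra_simps)
  then have "x = (1 / s) *\<^sub>R (orient x b c *\<^sub>R a + orient x c a *\<^sub>R b + orient x a b *\<^sub>R c)"
    using s by (simp flip: \<open>s *\<^sub>R x = _\<close>)
  then have "x = (orient x b c / s) *\<^sub>R a + (orient x c a / s) *\<^sub>R b + (orient x a b / s) *\<^sub>R c"
    by (simp add: scaleR_add_right)
  moreover have "orient x b c / s + orient x c a / s + orient x a b / s = 1"
    using s by (simp add: s_def flip: add_divide_distrib)
  moreover have "orient x b c / s \<ge> 0" "orient x c a / s \<ge> 0" "orient x a b / s \<ge> 0"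
    using assms s by simp_all
  ultimately show ?thesis unfolding convex_hull_3 by blast
qed

text \<open>The common point is explicit: \<open>t\<close> is the zero of the affine function
  \<open>orient a b\<close> along \<open>c d\<close>, and \<open>s\<close> that of
  \<open>orient c d\<close> along \<open>a b\<close>.\<close>

lemma open_segments_meet:
  assumes c: "orient a b c > 0" and d: "orient a b d < 0"
    and ab: "orient c d a * orient c d b < 0"
  shows "open_segment a b \<inter> open_segment c d \<noteq> {}"
proof -
  define D where "D = orient a b c - orient a b d"
  have D: "D > 0" using c d by (simp add: D_def)
  \<comment> \<open>Both differences are the same polynomial, so \<open>s\<close> and
    \<open>t\<close> share the denominator \<open>D\<close>.\<close>
  have D': "orient c d b - orient c d a = D"
    unfolding D_def orient_def by algebra
  then have a: "orient c d a < 0" and b: "orient c d b > 0"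
    using ab D by (auto simp: mult_less_0_iff)
  define t where "t = orient a b c / D"
  define s where "s = - orient c d a / D"
  have t: "0 < t" "t < 1" using c d D by (simp_all add: t_def D_def)
  have s: "0 < s" "s < 1" using a b D D' by (simp_all add: s_def field_simps)
  \<comment> \<open>Scaling by \<open>D\<close> clears the denominators and leaves a polynomial
    identity in each coordinate.\<close>
  have "D *\<^sub>R ((1 - s) *\<^sub>R a + s *\<^sub>R b) = (D - D * s) *\<^sub>R a + (D * s) *\<^sub>R b"
    by (simp add: algebra_simps)
  also have "\<dots> = (D - D * t) *\<^sub>R c + (D * t) *\<^sub>R d"
  proof -
    have coeffs: "D * s = - orient c d a" "D * t = orient a b c"
      using D by (simp_all add: s_def t_def)
    show ?thesis
      unfolding coeffs unfolding D_def vec_eq_iff forall_2 orient_def by (simp add: algebra_simps)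
  qed
  also have "\<dots> = D *\<^sub>R ((1 - t) *\<^sub>R c + t *\<^sub>R d)"
    by (simp add: algebra_simps)
  finally have z: "(1 - s) *\<^sub>R a + s *\<^sub>R b = (1 - t) *\<^sub>R c + t *\<^sub>R d"
    using D by simp
  have "a \<noteq> b" "c \<noteq> d" using a b c d by auto
  then have "(1 - s) *\<^sub>R a + s *\<^sub>R b \<in> open_segment a b"
      "(1 - s) *\<^sub>R a + s *\<^sub>R b \<in> open_segment c d"
    using s t z by (auto simp: in_segment)
  then show ?thesis by blast
qed

section \<open>Convex drawings as orientations\<close>

lemma convex_orientation_drawing:
  assumes "straight_line_drawing V E p" "convex_drawing V p"
  shows "convex_orientation V (\<lambda>a b c. orient (p a) (p b) (p c) > 0)"
proof
  show "finite V" using assms unfolding straight_line_drawing_def simple_graph_def by blast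
next
  fix a b c
  assume "orient (p a) (p b) (p c) > 0"
  then show "orient (p b) (p c) (p a) > 0" "\<not> orient (p b) (p a) (p c) > 0"
    using orient_rotate[of "p b" "p c" "p a"] orient_swap[of "p b" "p a" "p c"] by auto
next
  fix a b c
  assume "a \<in> V" "b \<in> V" "c \<in> V" "a \<noteq> b" "b \<noteq> c" "a \<noteq> c"
  then have "orient (p a) (p b) (p c) \<noteq> 0"
    using assms(1) collinear_if_orient_eq_0 unfolding straight_line_drawing_def by blast
  then show "orient (p a) (p b) (p c) > 0 \<or> orient (p b) (p a) (p c) > 0"
    using orient_swap[of "p b" "p a"] by auto
next
  fix x a b c
  assume V: "x \<in> V" "a \<in> V" "b \<in> V" "c \<in> V"
    and pos: "orient (p x) (p a) (p b) > 0" "orient (p x) (p b) (p c) > 0"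
  show "\<not> orient (p x) (p c) (p a) > 0"
  proof
    assume "orient (p x) (p c) (p a) > 0"
    then have x: "p x \<in> convex hull {p a, p b, p c}"
      using in_triangle_if_orient_pos pos by blast
    \<comment> \<open>Deleting an extreme point keeps the hull convex. It still contains the corners
      of the triangle, hence the whole triangle, which therefore misses \<open>p x\<close>.\<close>
    let ?H = "convex hull (p ` V)"
    have "p x extreme_point_of ?H"
      using assms(2) V unfolding convex_drawing_def by blast
    then have "convex (?H - {p x})"
      by (simp add: extreme_point_of_stillconvex)
    moreover have "p x \<noteq> p a" "p x \<noteq> p b" "p x \<noteq> p c"
      using pos by (auto simp: orient_def)
    then have "{p a, p b, p c} \<subseteq> ?H - {p x}"
      using V by (auto intro: hull_inc)
    ultimately have "convex hull {p a, p b, p c} \<subseteq> ?H - {p x}"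
      by (simp add: subset_hull)
    then show False using x by blast
  qed
qed

text \<open>At a common point, \<open>orient (p a) (p b)\<close> vanishes as a positively weighted
  mean of its values at \<open>c\<close> and \<open>d\<close>, so these have opposite signs unless
  both are 0. Conversely, symmetric separation gives the sign conditions of
  \<open>open_segments_meet\<close>.\<close>

lemma crosses_iff_crossing:
  assumes "straight_line_drawing V E p" "convex_drawing V p"
    and e: "e \<subseteq> V" "card e = 2" and f: "f \<subseteq> V" "card f = 2"
  shows "crosses p e f \<longleftrightarrow> convex_orientation.crossing (\<lambda>a b c. orient (p a) (p b) (p c) > 0) e f"
proof -
  interpret convex_orientation V "\<lambda>a b c. orient (p a) (p b) (p c) > 0"
    by (rule convex_orientation_drawing[OF assms(1,2)])
  obtain a b where ab: "e = {a, b}" "a \<noteq> b" "a \<in> V" "b \<in> V"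
    using e by (auto simp: card_2_iff)
  obtain c d where cd: "f = {c, d}" "c \<noteq> d" "c \<in> V" "d \<in> V"
    using f by (auto simp: card_2_iff)
  have inj: "inj_on p V" using assms(1) unfolding straight_line_drawing_def by blast
  then have ne: "p a \<noteq> p b" "p c \<noteq> p d" using ab cd by (auto dest: inj_onD)
  have iff: "crosses p e f \<longleftrightarrow> e \<noteq> f \<and> open_segment (p a) (p b) \<inter> open_segment (p c) (p d) \<noteq> {}"
    using ne unfolding crosses_def ab(1) cd(1)
    by (simp add: rel_interior_closed_segment flip: segment_convex_hull)
  have sep: "separates a b c d \<longleftrightarrow> orient (p a) (p b) (p c) * orient (p a) (p b) (p d) < 0"
    for a b c d
    unfolding separates_def orient_swap[of "p b" "p a"] by (auto simp: mult_less_0_iff)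
  have "crosses p e f \<longleftrightarrow> separates a b c d"
  proof
    assume cr: "crosses p e f"
    then obtain z where z: "z \<in> open_segment (p a) (p b)" "z \<in> open_segment (p c) (p d)"
      using iff by blast
    from z(1) have "orient (p a) (p b) z = 0"
      by (auto simp: in_segment orient_affine orient_self)
    moreover from z(2) obtain u where u: "0 < u" "u < 1" "z = (1 - u) *\<^sub>R p c + u *\<^sub>R p d"
      by (auto simp: in_segment)
    ultimately have eq: "(1 - u) * orient (p a) (p b) (p c) + u * orient (p a) (p b) (p d) = 0"
      by (simp add: orient_affine)
    have nz: "orient (p a) (p b) (p w) \<noteq> 0" if "w \<in> V" "w \<noteq> a" "w \<noteq> b" for w
      using ccw_total[of a b w] ab that orient_swap[of "p b" "p a" "p w"] by auto
    have "e \<noteq> f" using cr iff by blast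
    \<comment> \<open>Since \<open>e\<close> and \<open>f\<close> differ, \<open>f\<close> has an
      end outside \<open>e\<close>, and by general position that end is off the line of
      \<open>e\<close>.\<close>
    then have "orient (p a) (p b) (p c) \<noteq> 0 \<or> orient (p a) (p b) (p d) \<noteq> 0"
      using nz[of c] nz[of d] ab cd by auto
    then show "separates a b c d"
      unfolding sep using eq u
      by (smt (verit) mult_less_0_iff mult_pos_pos mult_neg_neg mult_pos_neg mult_eq_0_iff)
  next
    assume s: "separates a b c d"
    have "e \<noteq> f" using separates_distinct[OF s] ab cd by auto
    \<comment> \<open>Proved with \<open>c\<close> on the left of \<open>a b\<close>; exchanging
      \<open>c\<close> and \<open>d\<close> covers the other case.\<close>
    moreover have "open_segment (p a) (p b) \<inter> open_segment (p c) (p d) \<noteq> {}"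
      if s: "separates a b c d" and pos: "orient (p a) (p b) (p c) > 0" and V: "c \<in> V" "d \<in> V" for c d
    proof (rule open_segments_meet)
      show "orient (p a) (p b) (p d) < 0" using s pos unfolding sep by (simp add: mult_less_0_iff)
      show "orient (p c) (p d) (p a) * orient (p c) (p d) (p b) < 0"
        using separates_sym[of a b c d] s ab V unfolding sep by blast
    qed (fact pos)
    from this[of c d] this[of d c]
    have "open_segment (p a) (p b) \<inter> open_segment (p c) (p d) \<noteq> {}"
      using s cd separates_commute(2)[of a b c d] open_segment_commute[of "p c"]
      unfolding separates_def by metis
    ultimately show "crosses p e f" using iff by blast
  qed
  then show ?thesis using ab cd crossing_pairs by simp
qed

theorem theorem2p8:
  fixes V :: "'a set" and E :: "'a set set" and p :: "'a \<Rightarrow> real ^ 2"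
    and \<phi> :: "'a set \<Rightarrow> nat" and n :: nat
  assumes "n \<ge> 3"
    and "card V = n"
    and "precolored_theta3_drawing V E p \<phi>"
    and "convex_drawing V p"
    and "saturated V E p \<phi>"
  shows "real (card E) \<ge> 5 / 2 * real n - 6"
proof -
  have drawing: "straight_line_drawing V E p" and col: "\<phi> \<in> E \<rightarrow> {1, 2, 3}"
    and mono: "no_monochromatic_crossing E p \<phi>"
    using assms(3) unfolding precolored_theta3_drawing_def by auto
  interpret convex_orientation V "\<lambda>a b c. orient (p a) (p b) (p c) > 0"
    by (rule convex_orientation_drawing[OF drawing assms(4)])
  have E: "E \<subseteq> pairs V"
    using drawing by (auto simp: straight_line_drawing_def simple_graph_def pairs_def)
  have iff: "crosses p e f \<longleftrightarrow> crossing e f" if "e \<in> pairs V" "f \<in> pairs V" for e f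
    using crosses_iff_crossing[OF drawing assms(4)] that by (simp add: pairs_def)
  have "5 * card V \<le> 2 * card E + 12"
  proof (rule card_saturated_three_colouring[OF _ E col])
    show "3 \<le> card V" using assms by simp
    show "\<not> crossing e f" if "e \<in> E" "f \<in> E" "\<phi> e = \<phi> f" for e f
      using mono that iff E unfolding no_monochromatic_crossing_def by blast
  next
    fix e i assume e: "e \<in> pairs V" "e \<notin> E" and i: "i \<in> {1, 2, 3 :: nat}"
    obtain u v where uv: "e = {u, v}" "u \<noteq> v" "u \<in> V" "v \<in> V" using pairsE[OF e(1)] by metis
    have "\<not> no_monochromatic_crossing (insert e E) p (\<phi>(e := i))"
      using assms(5) uv e(2) i unfolding saturated_def by blast
    then obtain g f where gf: "g \<in> insert e E" "f \<in> insert e E"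
        "(\<phi>(e := i)) g = (\<phi>(e := i)) f" "crosses p g f"
      unfolding no_monochromatic_crossing_def by blast
    have "g \<noteq> f" using gf(4) unfolding crosses_def by blast
    \<comment> \<open>Colouring \<open>e\<close> changes no colour on \<open>E\<close>, so the
      monochromatic crossing must involve \<open>e\<close>, and its partner has colour
      \<open>i\<close>.\<close>
    moreover have "\<not> (g \<in> E \<and> f \<in> E)"
      using gf e(2) mono unfolding no_monochromatic_crossing_def by (metis fun_upd_other)
    moreover have sym: "crosses p f g" using gf(4) unfolding crosses_def by blast
    ultimately obtain h where "h \<in> E" "\<phi> h = i" "crosses p e h"
      using gf e(2) by (metis fun_upd_other fun_upd_same insertE)
    then show "\<exists>f\<in>E. \<phi> f = i \<and> crossing e f" using iff[OF e(1)] E by blast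
  qed
  then have "5 * real n \<le> 2 * real (card E) + 12"
    using assms(2) by linarith
  then show ?thesis by simp
qed

end
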